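(* Let $P=\Lambda^{\Psi}$ be a real number with $1<P<\infty$. Then the dual space of the $\theta$-Lebesgue sequence space $\ell_{P}(\mathbb{N})$ is $\ell_{P/(P-1)}(\mathbb{N})$; that is, the space of bounded linear functionals on $\ell_P(\mathbb{N})$ with the operator norm is isometrically isomorphic to $\ell_{P/(P-1)}(\mathbb{N})$.
   Context: Let $S,T$ be compact (Hausdorff) spaces, let $C(S)$, $C(T)$ be the spaces of real-valued continuous functions on them, and let $\omega: C(S)\times C(T)\to\mathbb{R}$ be a bounded bilinear form. Fix sequences $(\alpha_k)_{k\in\mathbb{N}}$ in $C(S)$ and $(\beta_k)_{k\in\mathbb{N}}$ in $C(T)$. The exponent is written $\Lambda^{\Psi}=\Lambda(p)^{\Psi(p)}=\theta(p)$, the value of a strictly increasing function $\theta$ ranging between $1$ and $\infty$, with the argument $p$ suppressed; it is used only as a real number, here called $P$. For a real exponent $1\le r<\infty$, the $\theta$-Lebesgue sequence space $\ell_r=\ell_r(\mathbb{N})$ is the set of all real sequences of the form $\mathbf{x}=\{\omega(\alpha_k,\beta_k)x_k\}_{k\in\mathbb{N}}$, with $x_k\in\mathbb{R}$, such that $\sum_{k=1}^{\infty}|\omega(\alpha_k,\beta_k)x_k|^{r}<\infty$. It is a subspace of the vector space of all real sequences (coordinatewise operations), with norm $$\|\mathbf{x}\|_{\ell_r}=\Big(\sum_{k=1}^{\infty}|\omega(\alpha_k,\beta_k)x_k|^{r}\Big)^{1/r}.$$ The same data $\omega,(\alpha_k),(\beta_k)$ are used for both exponents $r=P$ and $r=P/(P-1)$.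 *)

theory Defs
  imports "HOL-Analysis.Analysis"
begin

text \<open>A real normed space on an explicit carrier. The library class
  \<open>real_normed_vector\<close> is tied to whole types, whereas the carriers below depend on real
  exponents and on a bilinear form.\<close>

record 'a normed_sp =
  carr :: "'a set"
  add :: "'a \<Rightarrow> 'a \<Rightarrow> 'a"
  scal :: "real \<Rightarrow> 'a \<Rightarrow> 'a"
  nrm :: "'a \<Rightarrow> real"

definition linear_betw :: "'a normed_sp \<Rightarrow> 'b normed_sp \<Rightarrow> ('a \<Rightarrow> 'b) \<Rightarrow> bool" where
  "linear_betw V W f \<longleftrightarrow>
     (\<forall>x\<in>carr V. f x \<in> carr W) \<and>
     (\<forall>x\<in>carr V. \<forall>y\<in>carr V. f (add V x y) = add W (f x) (f y)) \<and>
     (\<forall>c. \<forall>x\<in>carr V. f (scal V c x) = scal W c (f x))"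

definition isometrically_isomorphic :: "'a normed_sp \<Rightarrow> 'b normed_sp \<Rightarrow> bool" where
  "isometrically_isomorphic V W \<longleftrightarrow>
     (\<exists>J. linear_betw V W J \<and> bij_betw J (carr V) (carr W) \<and>
          (\<forall>x\<in>carr V. nrm W (J x) = nrm V x))"

definition real_line :: "real normed_sp" where
  "real_line = \<lparr>carr = UNIV, add = (+), scal = (*), nrm = abs\<rparr>"

text \<open>Functionals are extensional, i.e. equal to \<open>undefined\<close> off the carrier, so that two
  functionals are equal iff they agree on the carrier.\<close>

definition dual_space :: "'a normed_sp \<Rightarrow> ('a \<Rightarrow> real) normed_sp" where
  "dual_space V =
     \<lparr>carr = {f \<in> extensional (carr V). linear_betw V real_line f \<and>
                (\<exists>C. \<forall>x\<in>carr V. \<bar>f x\<bar> \<le> C * nrm V x)},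
      add = (\<lambda>f g. \<lambda>x\<in>carr V. f x + g x),
      scal = (\<lambda>c f. \<lambda>x\<in>carr V. c * f x),
      nrm = (\<lambda>f. Sup {\<bar>f x\<bar> | x. x \<in> carr V \<and> nrm V x \<le> 1})\<rparr>"

text \<open>Here \<open>w k\<close> plays the role of \<open>\<omega>(\<alpha>\<^sub>k, \<beta>\<^sub>k)\<close>. The elements are the
  weighted sequences themselves, so the norm is computed from their entries.\<close>

definition weighted_lp :: "(nat \<Rightarrow> real) \<Rightarrow> real \<Rightarrow> (nat \<Rightarrow> real) normed_sp" where
  "weighted_lp w r =
     \<lparr>carr = {(\<lambda>k. w k * x k) | x. summable (\<lambda>k. \<bar>w k * x k\<bar> powr r)},
      add = (\<lambda>x y k. x k + y k),
      scal = (\<lambda>c x k. c * x k),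
      nrm = (\<lambda>x. (\<Sum>k. \<bar>x k\<bar> powr r) powr (1 / r))\<rparr>"

text \<open>On a compact space, \<open>'s \<Rightarrow>\<^sub>C real\<close> is the space of all real continuous functions with
  the sup norm.\<close>

definition theta_lebesgue ::
  "(('s::topological_space \<Rightarrow>\<^sub>C real) \<Rightarrow> ('t::topological_space \<Rightarrow>\<^sub>C real) \<Rightarrow> real) \<Rightarrow>
   (nat \<Rightarrow> ('s \<Rightarrow>\<^sub>C real)) \<Rightarrow> (nat \<Rightarrow> ('t \<Rightarrow>\<^sub>C real)) \<Rightarrow> real \<Rightarrow> (nat \<Rightarrow> real) normed_sp" where
  "theta_lebesgue \<omega> \<alpha> \<beta> r = weighted_lp (\<lambda>k. \<omega> (\<alpha> k) (\<beta> k)) r"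

end

theory Submission
  imports Defs
begin

text \<open>The weighted space is the subspace of the classical sequence space consisting of the sequences
  that vanish wherever the weight does. A functional \<open>f\<close> is sent to the sequence of its values on the
  unit vectors at the remaining coordinates. Testing \<open>f\<close> against truncations of
  \<open>sgn (y k) * \<bar>y k\<bar> powr (q - 1)\<close> shows that this sequence \<open>y\<close> has \<open>q\<close>-norm at most the norm of
  \<open>f\<close>, Hoelder's inequality gives the converse estimate, and density of the finitely supported sequences
  shows that \<open>f\<close> is pairing with \<open>y\<close>.\<close>

section \<open>The r-norm of a sequence, Hoelder's inequality and vanishing tails\<close>

definition lp_norm :: "real \<Rightarrow> (nat \<Rightarrow> real) \<Rightarrow> real" where
  "lp_norm r x = (\<Sum>k. \<bar>x k\<bar> powr r) powr (1 / r)"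

lemma lp_norm_nonneg [simp]: "0 \<le> lp_norm r x"
  by (simp add: lp_norm_def)

lemma lp_norm_scale:
  assumes "summable (\<lambda>k. \<bar>x k\<bar> powr r)" "0 < r"
  shows "lp_norm r (\<lambda>k. c * x k) = \<bar>c\<bar> * lp_norm r x"
  using assms by (simp add: lp_norm_def abs_mult powr_mult suminf_mult powr_powr)

lemma lp_norm_powr:
  assumes "summable (\<lambda>k. \<bar>x k\<bar> powr r)" "0 < r"
  shows "lp_norm r x powr r = (\<Sum>k. \<bar>x k\<bar> powr r)"
  using assms by (simp add: lp_norm_def powr_powr suminf_nonneg)

lemma lp_norm_eq_0:
  assumes "summable (\<lambda>k. \<bar>x k\<bar> powr r)" "lp_norm r x = 0"
  shows "x k = 0"
  using assms by (simp add: lp_norm_def suminf_eq_zero_iff)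

text \<open>Scaling by \<open>a = lp_norm p x\<close> and \<open>b = lp_norm q y\<close> reduces to sequences of norm one, where
  Young's inequality can be summed.\<close>

lemma Hoelder_series:
  assumes pq: "1 < p" "1 < q" "1 / p + 1 / q = (1::real)"
    and x: "summable (\<lambda>k. \<bar>x k\<bar> powr p)" and y: "summable (\<lambda>k. \<bar>y k\<bar> powr q)"
  shows "summable (\<lambda>k. x k * y k)" "\<bar>\<Sum>k. x k * y k\<bar> \<le> lp_norm p x * lp_norm q y"
proof -
  define a b where "a = lp_norm p x" and "b = lp_norm q y"
  have *: "summable (\<lambda>k. x k * y k) \<and> \<bar>\<Sum>k. x k * y k\<bar> \<le> a * b"
  proof (cases "a = 0 \<or> b = 0")
    \<comment> \<open>A sequence of norm zero vanishes identically, so both sides are 0. This case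
      is split off because the other one divides by \<open>a\<close> and \<open>b\<close>.\<close>
    case True
    then have "(\<lambda>k. x k * y k) = (\<lambda>k. 0)"
      using lp_norm_eq_0[OF x] lp_norm_eq_0[OF y] by (auto simp: a_def b_def fun_eq_iff)
    then show ?thesis using True by auto
  next
    case False
    then have ab: "a > 0" "b > 0"
      using lp_norm_nonneg by (auto simp: a_def b_def less_le)
    \<comment> \<open>Young's bound for \<open>\<bar>x k\<bar> / a\<close> and
      \<open>\<bar>y k\<bar> / b\<close>, multiplied back by \<open>a * b\<close>. After summation
      the bracket becomes \<open>1 / p + 1 / q = 1\<close>.\<close>
    let ?h = "\<lambda>k. a * b * ((\<bar>x k\<bar> powr p) * (1 / (a powr p * p)) + (\<bar>y k\<bar> powr q) * (1 / (b powr q * q)))"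
    have le: "\<bar>x k * y k\<bar> \<le> ?h k" for k
    proof -
      have "(\<bar>x k\<bar> / a) * (\<bar>y k\<bar> / b) \<le> (\<bar>x k\<bar> / a) powr p / p + (\<bar>y k\<bar> / b) powr q / q"
        using pq ab by (intro Youngs_inequality) auto
      then show ?thesis
        using ab by (simp add: powr_divide abs_mult pos_divide_le_eq mult.commute)
    qed
    have h: "?h sums (a * b * ((a powr p) * (1 / (a powr p * p)) + (b powr q) * (1 / (b powr q * q))))"
      using x y pq unfolding a_def b_def
      by (intro sums_mult sums_add sums_mult2)
         (simp_all add: lp_norm_powr summable_sums)
    have "(a powr p) * (1 / (a powr p * p)) + (b powr q) * (1 / (b powr q * q)) = 1"
      using ab pq by simp
    with h have h: "?h sums (a * b)" by simp
    have s: "summable (\<lambda>k. \<bar>x k * y k\<bar>)"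
      using le by (intro summable_comparison_test'[OF sums_summable[OF h]]) auto
    have "\<bar>\<Sum>k. x k * y k\<bar> \<le> (\<Sum>k. \<bar>x k * y k\<bar>)" by (rule summable_rabs[OF s])
    also have "\<dots> \<le> a * b"
      using suminf_le[OF le s sums_summable[OF h]] h by (simp add: sums_iff)
    finally show ?thesis using summable_rabs_cancel[OF s] by simp
  qed
  then show "summable (\<lambda>k. x k * y k)" "\<bar>\<Sum>k. x k * y k\<bar> \<le> lp_norm p x * lp_norm q y"
    by (auto simp: a_def b_def)
qed

text \<open>The p-th power of the tail norm is the full series minus its n-th partial sum. This
  gives the density of the finitely supported sequences.\<close>

lemma lp_tail_tendsto_0:
  assumes "summable (\<lambda>k. \<bar>x k\<bar> powr p)" "0 < p"
  shows "(\<lambda>n. lp_norm p (\<lambda>k. if k < n then 0 else x k)) \<longlonglongrightarrow> 0"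
proof -
  have "(\<Sum>k. \<bar>if k < n then 0 else x k\<bar> powr p) = (\<Sum>k. \<bar>x k\<bar> powr p) - (\<Sum>k<n. \<bar>x k\<bar> powr p)" for n
  proof -
    have "(\<lambda>k. if k \<in> {..<n} then \<bar>x k\<bar> powr p else 0) sums (\<Sum>k<n. \<bar>x k\<bar> powr p)"
      by (rule sums_If_finite_set) simp
    from sums_diff[OF summable_sums[OF assms(1)] this] show ?thesis
      by (subst sums_unique, assumption) (auto intro!: arg_cong[where f=suminf])
  qed
  moreover have "(\<lambda>n. ((\<Sum>k. \<bar>x k\<bar> powr p) - (\<Sum>k<n. \<bar>x k\<bar> powr p))) \<longlonglongrightarrow> 0"
    using tendsto_diff[OF tendsto_const[of "\<Sum>k. \<bar>x k\<bar> powr p"] summable_LIMSEQ[OF assms(1)]]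
    by simp
  ultimately have "(\<lambda>n. (\<Sum>k. \<bar>if k < n then 0 else x k\<bar> powr p)) \<longlonglongrightarrow> 0" by simp
  moreover have "summable (\<lambda>k. \<bar>if k < n then 0 else x k\<bar> powr p)" for n
    by (rule summable_comparison_test'[OF assms(1)]) auto
  \<comment> \<open>The base tends to 0, so passing to the limit under \<open>powr\<close> uses that
    the sums are nonnegative and that \<open>1 / p\<close> is positive.\<close>
  ultimately have "(\<lambda>n. (\<Sum>k. \<bar>if k < n then 0 else x k\<bar> powr p) powr (1 / p)) \<longlonglongrightarrow> 0 powr (1 / p)"
    using assms(2) by (intro tendsto_powr') (auto intro!: always_eventually suminf_nonneg)
  then show ?thesis by (simp add: lp_norm_def)
qed

section \<open>The weighted space as a space of sequences\<close>

lemma weighted_lp_carr: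
  "x \<in> carr (weighted_lp w r) \<longleftrightarrow> (\<forall>k. w k = 0 \<longrightarrow> x k = 0) \<and> summable (\<lambda>k. \<bar>x k\<bar> powr r)"
proof
  assume R: "(\<forall>k. w k = 0 \<longrightarrow> x k = 0) \<and> summable (\<lambda>k. \<bar>x k\<bar> powr r)"
  \<comment> \<open>Dividing by the weight recovers the unweighted sequence. Where
    \<open>w k = 0\<close> the quotient is 0 by convention, which agrees with
    \<open>x k = 0\<close>.\<close>
  then have "(\<lambda>k. w k * (x k / w k)) = x" by (auto simp: fun_eq_iff)
  moreover have "\<bar>w k * (x k / w k)\<bar> = \<bar>x k\<bar>" for k using R by auto
  ultimately show "x \<in> carr (weighted_lp w r)"
    using R unfolding weighted_lp_def
    by (auto simp only: normed_sp.simps mem_Collect_eq intro!: exI[of _ "\<lambda>k. x k / w k"])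
qed (auto simp: weighted_lp_def)

lemma weighted_lp_simps [simp]:
  "add (weighted_lp w r) x y = (\<lambda>k. x k + y k)"
  "scal (weighted_lp w r) c x = (\<lambda>k. c * x k)"
  "nrm (weighted_lp w r) x = lp_norm r x"
  by (simp_all add: weighted_lp_def lp_norm_def)

lemma weighted_lp_finite_support:
  assumes "\<And>k. w k = 0 \<Longrightarrow> x k = 0" "\<And>k. k \<ge> n \<Longrightarrow> x k = 0"
  shows "x \<in> carr (weighted_lp w r)"
  unfolding weighted_lp_carr
proof safe
  show "summable (\<lambda>k. \<bar>x k\<bar> powr r)"
    using assms(2) by (intro summable_finite[of "{..<n}"]) auto
qed (use assms in auto)

lemma weighted_lp_scale:
  "x \<in> carr (weighted_lp w r) \<Longrightarrow> (\<lambda>k. c * x k) \<in> carr (weighted_lp w r)"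
  by (auto simp: weighted_lp_carr abs_mult powr_mult)

text \<open>Only closure is at stake, so the crude bound of a sum by twice the maximum replaces
  Minkowski's inequality.\<close>

lemma weighted_lp_add:
  assumes x: "x \<in> carr (weighted_lp w r)" and y: "y \<in> carr (weighted_lp w r)" and r: "0 < r"
  shows "(\<lambda>k. x k + y k) \<in> carr (weighted_lp w r)"
proof -
  have "\<bar>x k + y k\<bar> powr r \<le> 2 powr r * (\<bar>x k\<bar> powr r + \<bar>y k\<bar> powr r)" for k
  proof -
    have "\<bar>x k + y k\<bar> powr r \<le> (2 * max \<bar>x k\<bar> \<bar>y k\<bar>) powr r"
      using r by (intro powr_mono2) auto
    also have "\<dots> = 2 powr r * max \<bar>x k\<bar> \<bar>y k\<bar> powr r" by (rule powr_mult)
    also have "\<dots> \<le> 2 powr r * (\<bar>x k\<bar> powr r + \<bar>y k\<bar> powr r)"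
      by (intro mult_left_mono) (auto simp: max_def)
    finally show ?thesis .
  qed
  then have le: "norm (\<bar>x k + y k\<bar> powr r) \<le> 2 powr r * (\<bar>x k\<bar> powr r + \<bar>y k\<bar> powr r)" for k
    by simp
  have "summable (\<lambda>k. 2 powr r * (\<bar>x k\<bar> powr r + \<bar>y k\<bar> powr r))"
    using x y by (auto simp: weighted_lp_carr intro!: summable_mult summable_add)
  then have "summable (\<lambda>k. \<bar>x k + y k\<bar> powr r)"
    by (rule summable_comparison_test'[OF _ le])
  with x y show ?thesis by (simp add: weighted_lp_carr)
qed

section \<open>Bounded functionals and the operator norm\<close>

lemma dual_carr:
  "f \<in> carr (dual_space (weighted_lp w p)) \<longleftrightarrow>
     f \<in> extensional (carr (weighted_lp w p)) \<and>
     (\<forall>x\<in>carr (weighted_lp w p). \<forall>y\<in>carr (weighted_lp w p). f (\<lambda>k. x k + y k) = f x + f y) \<and>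
     (\<forall>c. \<forall>x\<in>carr (weighted_lp w p). f (\<lambda>k. c * x k) = c * f x) \<and>
     (\<exists>C. \<forall>x\<in>carr (weighted_lp w p). \<bar>f x\<bar> \<le> C * lp_norm p x)"
  by (simp add: dual_space_def linear_betw_def real_line_def)

lemma dual_add:
  assumes "f \<in> carr (dual_space (weighted_lp w p))"
    and "x \<in> carr (weighted_lp w p)" "y \<in> carr (weighted_lp w p)"
  shows "f (\<lambda>k. x k + y k) = f x + f y"
  using assms by (simp add: dual_carr)

lemma dual_scale:
  assumes "f \<in> carr (dual_space (weighted_lp w p))" and "x \<in> carr (weighted_lp w p)"
  shows "f (\<lambda>k. c * x k) = c * f x"
  using assms by (simp add: dual_carr)

lemma dual_norm_le:
  assumes "\<And>x. x \<in> carr (weighted_lp w p) \<Longrightarrow> \<bar>f x\<bar> \<le> K * lp_norm p x" "0 \<le> K"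
  shows "nrm (dual_space (weighted_lp w p)) f \<le> K"
proof -
  \<comment> \<open>The zero sequence makes the set under \<open>Sup\<close> nonempty.\<close>
  have 0: "(\<lambda>k. 0) \<in> carr (weighted_lp w p)" by (simp add: weighted_lp_carr)
  have "Sup {\<bar>f x\<bar> | x. x \<in> carr (weighted_lp w p) \<and> lp_norm p x \<le> 1} \<le> K"
  proof (rule cSup_least)
    show "{\<bar>f x\<bar> | x. x \<in> carr (weighted_lp w p) \<and> lp_norm p x \<le> 1} \<noteq> {}"
      using 0 by (auto simp: lp_norm_def intro!: exI[of _ "\<lambda>k. 0"])
  next
    fix t assume "t \<in> {\<bar>f x\<bar> | x. x \<in> carr (weighted_lp w p) \<and> lp_norm p x \<le> 1}"
    then obtain x where "t = \<bar>f x\<bar>" "x \<in> carr (weighted_lp w p)" "lp_norm p x \<le> 1" by blast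
    then show "t \<le> K"
      using assms(1)[of x] mult_left_mono[of "lp_norm p x" 1 K] assms(2) by simp
  qed
  then show ?thesis by (simp add: dual_space_def)
qed

lemma dual_norm_upper:
  assumes f: "f \<in> carr (dual_space (weighted_lp w p))"
    and x: "x \<in> carr (weighted_lp w p)" "lp_norm p x \<le> 1"
  shows "\<bar>f x\<bar> \<le> nrm (dual_space (weighted_lp w p)) f"
proof -
  let ?S = "{\<bar>f x\<bar> | x. x \<in> carr (weighted_lp w p) \<and> lp_norm p x \<le> 1}"
  obtain C where C: "\<And>x. x \<in> carr (weighted_lp w p) \<Longrightarrow> \<bar>f x\<bar> \<le> C * lp_norm p x"
    using f unfolding dual_carr by blast
  have "bdd_above ?S"
  proof (rule bdd_aboveI)
    fix t assume "t \<in> ?S"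
    then obtain x where x: "t = \<bar>f x\<bar>" "x \<in> carr (weighted_lp w p)" "lp_norm p x \<le> 1" by blast
    have "t \<le> C * lp_norm p x" using C x by simp
    \<comment> \<open>The constant \<open>C\<close> may be negative, hence the bound by its absolute
      value.\<close>
    also have "\<dots> \<le> \<bar>C\<bar> * 1" using x(3) by (intro mult_mono) auto
    finally show "t \<le> \<bar>C\<bar>" by simp
  qed
  then have "\<bar>f x\<bar> \<le> Sup ?S" using x by (intro cSup_upper) auto
  then show ?thesis by (simp add: dual_space_def)
qed

lemma dual_norm_nonneg:
  assumes "f \<in> carr (dual_space (weighted_lp w p))"
  shows "0 \<le> nrm (dual_space (weighted_lp w p)) f"
  using dual_norm_upper[OF assms, of "\<lambda>k. 0"] by (simp add: weighted_lp_carr lp_norm_def)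

text \<open>The supremum sees only the unit ball; normalising \<open>x\<close> and homogeneity carry
  the estimate to the whole space.\<close>

lemma dual_norm_bound:
  assumes f: "f \<in> carr (dual_space (weighted_lp w p))" and x: "x \<in> carr (weighted_lp w p)"
    and p: "0 < p"
  shows "\<bar>f x\<bar> \<le> nrm (dual_space (weighted_lp w p)) f * lp_norm p x"
proof (cases "lp_norm p x = 0")
  case True
  \<comment> \<open>Normalising is impossible here, but any bound \<open>C * lp_norm p x\<close> for
    \<open>f\<close> is 0, so \<open>f x = 0\<close>.\<close>
  then show ?thesis using f x by (force simp: dual_carr)
next
  case False
  then have pos: "lp_norm p x > 0" using lp_norm_nonneg[of p x] by linarith
  define c where "c = 1 / lp_norm p x"
  have "lp_norm p (\<lambda>k. c * x k) = 1"
    using x p pos by (subst lp_norm_scale) (auto simp: weighted_lp_carr c_def)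
  then have "\<bar>f (\<lambda>k. c * x k)\<bar> \<le> nrm (dual_space (weighted_lp w p)) f"
    using weighted_lp_scale[OF x] by (intro dual_norm_upper[OF f]) auto
  moreover have "f (\<lambda>k. c * x k) = c * f x" by (rule dual_scale[OF f x])
  ultimately have "\<bar>f x\<bar> / lp_norm p x \<le> nrm (dual_space (weighted_lp w p)) f"
    using pos by (simp add: c_def abs_mult)
  then show ?thesis using pos by (simp add: pos_divide_le_eq)
qed

section \<open>Coordinates of a functional and its series expansion\<close>

definition dual_coords :: "(nat \<Rightarrow> real) \<Rightarrow> ((nat \<Rightarrow> real) \<Rightarrow> real) \<Rightarrow> nat \<Rightarrow> real" where
  "dual_coords w f k = (if w k = 0 then 0 else f (\<lambda>j. of_bool (j = k)))"

text \<open>At a zero of the weight the unit vector lies outside the space, where an extensional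
  functional is \<open>undefined\<close>; hence the value 0 in \<open>dual_coords\<close>
  there.\<close>

lemma unit_carr: "w k \<noteq> 0 \<Longrightarrow> (\<lambda>j. of_bool (j = k)) \<in> carr (weighted_lp w r)"
  by (rule weighted_lp_finite_support[of _ _ "Suc k"]) auto

lemma dual_finite_support:
  assumes f: "f \<in> carr (dual_space (weighted_lp w p))" and x: "\<And>k. w k = 0 \<Longrightarrow> x k = 0"
  shows "f (\<lambda>k. if k < n then x k else 0) = (\<Sum>k<n. x k * dual_coords w f k)"
proof (induction n)
  case 0
  have "(\<lambda>k. 0) \<in> carr (weighted_lp w p)" by (simp add: weighted_lp_carr)
  \<comment> \<open>Writing 0 as \<open>0 * 0\<close> lets homogeneity with factor 0 yield that
    \<open>f\<close> vanishes at the zero sequence.\<close>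
  then have "f (\<lambda>k. 0 * 0) = 0 * f (\<lambda>k. 0)"
    by (rule dual_scale[OF f])
  then show ?case by simp
next
  case (Suc n)
  let ?t = "\<lambda>k. if k < n then x k else 0"
  show ?case
  proof (cases "w n = 0")
    \<comment> \<open>Here \<open>x n = 0\<close>, so neither the truncation nor the sum changes,
      and the unit vector at \<open>n\<close> is never evaluated.\<close>
    case True
    then have "(\<lambda>k. if k < Suc n then x k else 0) = ?t" using x by (auto simp: less_Suc_eq fun_eq_iff)
    with Suc True x show ?thesis by simp
  next
    case False
    have t: "?t \<in> carr (weighted_lp w p)"
      by (rule weighted_lp_finite_support[of _ _ n]) (use x in auto)
    have eq: "(\<lambda>k. if k < Suc n then x k else 0) = (\<lambda>k. ?t k + x n * of_bool (k = n))"
      by (auto simp: less_Suc_eq fun_eq_iff)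
    have "f (\<lambda>k. ?t k + x n * of_bool (k = n)) = f ?t + f (\<lambda>k. x n * of_bool (k = n))"
      by (rule dual_add[OF f t weighted_lp_scale[OF unit_carr[of w n p, OF False]]])
    also have "f (\<lambda>k. x n * of_bool (k = n)) = x n * f (\<lambda>k. of_bool (k = n))"
      by (rule dual_scale[OF f unit_carr[of w n p, OF False]])
    finally show ?thesis unfolding eq using Suc False by (simp add: dual_coords_def)
  qed
qed

text \<open>For the truncated test sequence \<open>?t\<close>, both \<open>f ?t\<close> and the p-th
  power of its norm equal the partial sum \<open>S\<close>, so
  \<open>S \<le> C * S powr (1 / p)\<close>. Cancelling leaves
  \<open>S powr (1 / q) \<le> C\<close>.\<close>

lemma dual_coords_partial_sum_le:
  assumes pq: "1 < p" "1 < q" "1 / p + 1 / q = (1::real)"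
    and f: "f \<in> carr (dual_space (weighted_lp w p))"
  shows "(\<Sum>k<n. \<bar>dual_coords w f k\<bar> powr q) \<le> nrm (dual_space (weighted_lp w p)) f powr q"
proof -
  define y where "y = dual_coords w f"
  define C where "C = nrm (dual_space (weighted_lp w p)) f"
  \<comment> \<open>The exponent is chosen so that \<open>(q - 1) * p = q\<close>; the sign makes
    each product \<open>x k * y k\<close> nonnegative.\<close>
  define x where "x k = sgn (y k) * \<bar>y k\<bar> powr (q - 1)" for k
  define S where "S = (\<Sum>k<n. \<bar>y k\<bar> powr q)"
  let ?t = "\<lambda>k. if k < n then x k else 0"
  have qp: "(q - 1) * p = q" using pq by (simp add: field_simps)
  have x0: "w k = 0 \<Longrightarrow> x k = 0" for k by (simp add: x_def y_def dual_coords_def)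
  have S0: "0 \<le> S" by (simp add: S_def sum_nonneg)
  have xy: "x k * y k = \<bar>y k\<bar> powr q" for k
  proof -
    have "x k * y k = \<bar>y k\<bar> * \<bar>y k\<bar> powr (q - 1)"
      by (simp add: x_def sgn_if)
    also have "\<dots> = \<bar>y k\<bar> powr q"
      by (subst powr_mult_base) auto
    finally show ?thesis .
  qed
  have xp: "\<bar>x k\<bar> powr p = \<bar>y k\<bar> powr q" for k
    using qp by (auto simp: x_def abs_mult abs_sgn_eq powr_powr)
  have "f ?t = S"
    using dual_finite_support[OF f, of x n] x0 by (simp add: y_def[symmetric] xy S_def)
  moreover have "(\<Sum>k. \<bar>?t k\<bar> powr p) = S"
    unfolding S_def by (subst suminf_finite[of "{..<n}"]) (auto simp: xp)
  then have "lp_norm p ?t = S powr (1 / p)" by (simp add: lp_norm_def)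
  moreover have "?t \<in> carr (weighted_lp w p)"
    by (rule weighted_lp_finite_support[of _ _ n]) (use x0 in auto)
  ultimately have le: "S \<le> C * S powr (1 / p)"
    using dual_norm_bound[OF f, of ?t] pq S0 by (simp add: C_def)
  have "S \<le> C powr q"
  proof (cases "S = 0")
    case False
    with S0 have S: "S > 0" by simp
    have "S = S powr (1 / q) * S powr (1 / p)"
      using S pq by (simp add: powr_add[symmetric] add.commute)
    with le S have "S powr (1 / q) \<le> C"
      by (metis mult_le_cancel_right_pos powr_gt_zero less_numeral_extra(3))
    then have "(S powr (1 / q)) powr q \<le> C powr q"
      using pq by (intro powr_mono2) auto
    then show ?thesis using S pq by (simp add: powr_powr)
  qed simp
  then show ?thesis by (simp add: S_def C_def y_def)
qed

text \<open>The bound on the partial sums does not depend on \<open>n\<close>, so it gives both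
  convergence and the estimate of the limit.\<close>

lemma dual_coords_carr:
  assumes pq: "1 < p" "1 < q" "1 / p + 1 / q = (1::real)"
    and f: "f \<in> carr (dual_space (weighted_lp w p))"
  shows "dual_coords w f \<in> carr (weighted_lp w q)"
    "lp_norm q (dual_coords w f) \<le> nrm (dual_space (weighted_lp w p)) f"
proof -
  let ?C = "nrm (dual_space (weighted_lp w p)) f"
  note le = dual_coords_partial_sum_le[OF pq f]
  have s: "summable (\<lambda>k. \<bar>dual_coords w f k\<bar> powr q)"
    by (rule summableI_nonneg_bounded[OF _ le]) simp
  then show "dual_coords w f \<in> carr (weighted_lp w q)"
    by (simp add: weighted_lp_carr dual_coords_def)
  have "lp_norm q (dual_coords w f) \<le> (?C powr q) powr (1 / q)"
    unfolding lp_norm_def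
    using pq s by (intro powr_mono2 suminf_le_const le suminf_nonneg) auto
  also have "\<dots> = ?C" using dual_norm_nonneg[OF f] pq by (simp add: powr_powr)
  finally show "lp_norm q (dual_coords w f) \<le> ?C" .
qed

text \<open>Split \<open>x\<close> into its truncation \<open>?h n\<close> and its tail
  \<open>?t n\<close>. The error of the n-th partial sum is \<open>f (?t n)\<close>, at most the
  norm of \<open>f\<close> times the vanishing norm of the tail.\<close>

lemma dual_coords_sums:
  assumes f: "f \<in> carr (dual_space (weighted_lp w p))" and x: "x \<in> carr (weighted_lp w p)"
    and p: "0 < p"
  shows "(\<lambda>k. x k * dual_coords w f k) sums f x"
proof -
  let ?C = "nrm (dual_space (weighted_lp w p)) f"
  let ?h = "\<lambda>n k. if k < n then x k else 0" and ?t = "\<lambda>n k. if k < n then 0 else x k"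
  have h: "?h n \<in> carr (weighted_lp w p)" for n
    by (rule weighted_lp_finite_support[of _ _ n]) (use x in \<open>auto simp: weighted_lp_carr\<close>)
  have "summable (\<lambda>k. \<bar>?t n k\<bar> powr p)" for n
    using x by (intro summable_comparison_test'[OF conjunct2[OF x[unfolded weighted_lp_carr]]]) auto
  then have t: "?t n \<in> carr (weighted_lp w p)" for n
    using x by (auto simp: weighted_lp_carr)
  have "f x - (\<Sum>k<n. x k * dual_coords w f k) = f (?t n)" for n
  proof -
    have "f (\<lambda>k. ?h n k + ?t n k) = f (?h n) + f (?t n)"
      by (rule dual_add[OF f h t])
    also have "(\<lambda>k. ?h n k + ?t n k) = x" by auto
    finally have "f x = f (?h n) + f (?t n)" .
    then show ?thesis using dual_finite_support[OF f, of x n] x by (simp add: weighted_lp_carr)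
  qed
  then have b: "\<bar>f x - (\<Sum>k<n. x k * dual_coords w f k)\<bar> \<le> ?C * lp_norm p (?t n)" for n
    using dual_norm_bound[OF f t p] by simp
  have "(\<lambda>n. ?C * lp_norm p (?t n)) \<longlonglongrightarrow> 0"
    using tendsto_mult_right_zero[OF lp_tail_tendsto_0, of x p] x p by (simp add: weighted_lp_carr)
  then have "(\<lambda>n. f x - (\<Sum>k<n. x k * dual_coords w f k)) \<longlonglongrightarrow> 0"
    by (rule Lim_null_comparison[rotated]) (use b in auto)
  then have "(\<lambda>n. (\<Sum>k<n. x k * dual_coords w f k)) \<longlonglongrightarrow> f x"
    using tendsto_diff[OF tendsto_const, of "\<lambda>n. f x - (\<Sum>k<n. x k * dual_coords w f k)" 0 sequentially "f x"]
    by simp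
  then show ?thesis by (simp add: sums_def)
qed

section \<open>The coordinate map is an isometric isomorphism\<close>

lemma dual_coords_norm:
  assumes pq: "1 < p" "1 < q" "1 / p + 1 / q = (1::real)"
    and f: "f \<in> carr (dual_space (weighted_lp w p))"
  shows "lp_norm q (dual_coords w f) = nrm (dual_space (weighted_lp w p)) f"
proof (rule antisym)
  show "nrm (dual_space (weighted_lp w p)) f \<le> lp_norm q (dual_coords w f)"
  proof (rule dual_norm_le)
    fix x assume x: "x \<in> carr (weighted_lp w p)"
    have "f x = (\<Sum>k. x k * dual_coords w f k)"
      using dual_coords_sums[OF f x] pq by (simp add: sums_iff)
    then show "\<bar>f x\<bar> \<le> lp_norm q (dual_coords w f) * lp_norm p x"
      using Hoelder_series(2)[OF pq, of x "dual_coords w f"] x dual_coords_carr(1)[OF pq f]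
      by (simp add: weighted_lp_carr mult.commute)
  qed simp
qed (rule dual_coords_carr[OF pq f])

lemma dual_coords_surj:
  assumes pq: "1 < p" "1 < q" "1 / p + 1 / q = (1::real)"
    and y: "y \<in> carr (weighted_lp w q)"
  shows "\<exists>f\<in>carr (dual_space (weighted_lp w p)). dual_coords w f = y"
proof
  \<comment> \<open>Pairing with \<open>y\<close>, restricted to the carrier so that it is
    extensional. Its linearity therefore also needs sums and multiples to stay in the
    carrier.\<close>
  define f where "f = (\<lambda>x\<in>carr (weighted_lp w p). \<Sum>k. x k * y k)"
  note H = Hoelder_series[OF pq, of _ y]
  have s: "summable (\<lambda>k. \<bar>y k\<bar> powr q)" using y by (simp add: weighted_lp_carr)
  show "f \<in> carr (dual_space (weighted_lp w p))"
    unfolding dual_carr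
  proof (intro conjI ballI allI exI)
    show "f \<in> extensional (carr (weighted_lp w p))" by (simp add: f_def)
  next
    fix x x' assume "x \<in> carr (weighted_lp w p)" "x' \<in> carr (weighted_lp w p)"
    then show "f (\<lambda>k. x k + x' k) = f x + f x'"
      using H(1)[OF _ s] weighted_lp_add[of x w p x'] pq
      by (simp add: f_def weighted_lp_carr distrib_right suminf_add)
  next
    fix c x assume "x \<in> carr (weighted_lp w p)"
    then show "f (\<lambda>k. c * x k) = c * f x"
      using H(1)[OF _ s] weighted_lp_scale[of x w p c]
      by (simp add: f_def weighted_lp_carr mult.assoc suminf_mult)
  next
    fix x assume "x \<in> carr (weighted_lp w p)"
    then show "\<bar>f x\<bar> \<le> lp_norm q y * lp_norm p x"
      using H(2)[OF _ s, of x] by (simp add: f_def weighted_lp_carr mult.commute)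
  qed
  show "dual_coords w f = y"
  proof
    fix k
    have "(\<Sum>j. of_bool (j = k) * y j) = y k"
      by (subst suminf_finite[of "{k}"]) auto
    \<comment> \<open>If \<open>w k = 0\<close>, the left side is 0 by definition and
      \<open>y k = 0\<close> by membership of \<open>y\<close>; otherwise \<open>f\<close> is
      evaluated at a unit vector.\<close>
    then show "dual_coords w f k = y k"
      using y unit_carr[of w k p] by (auto simp: dual_coords_def f_def weighted_lp_carr)
  qed
qed

lemma dual_weighted_lp:
  assumes pq: "1 < p" "1 < q" "1 / p + 1 / q = (1::real)"
  shows "isometrically_isomorphic (dual_space (weighted_lp w p)) (weighted_lp w q)"
  unfolding isometrically_isomorphic_def
proof (intro exI conjI ballI)
  let ?D = "dual_space (weighted_lp w p)"
  show "linear_betw ?D (weighted_lp w q) (dual_coords w)"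
    unfolding linear_betw_def
    \<comment> \<open>Sums and multiples of functionals are pointwise on the carrier, which contains
      every unit vector that \<open>dual_coords\<close> evaluates.\<close>
    by (auto simp: dual_coords_carr[OF pq]) (auto simp: dual_space_def dual_coords_def unit_carr)
  have "inj_on (dual_coords w) (carr ?D)"
  proof (rule inj_onI)
    fix f g assume f: "f \<in> carr ?D" and g: "g \<in> carr ?D" and eq: "dual_coords w f = dual_coords w g"
    show "f = g"
    \<comment> \<open>Agreement on the carrier suffices, and there both values are the sum of the
      same series.\<close>
    proof (rule extensionalityI)
      fix x assume x: "x \<in> carr (weighted_lp w p)"
      show "f x = g x"
        using dual_coords_sums[OF f x] dual_coords_sums[OF g x] pq
        by (auto simp: eq intro: sums_unique2)
    qed (use f g in \<open>auto simp: dual_carr\<close>)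
  qed
  then show "bij_betw (dual_coords w) (carr ?D) (carr (weighted_lp w q))"
    unfolding bij_betw_def using dual_coords_carr(1)[OF pq] dual_coords_surj[OF pq] by blast
  show "nrm (weighted_lp w q) (dual_coords w f) = nrm ?D f" if "f \<in> carr ?D" for f
    using dual_coords_norm[OF pq that] by simp
qed

theorem theorem4:
  fixes \<omega> :: "('s::t2_space \<Rightarrow>\<^sub>C real) \<Rightarrow> ('t::t2_space \<Rightarrow>\<^sub>C real) \<Rightarrow> real"
    and \<alpha> :: "nat \<Rightarrow> ('s \<Rightarrow>\<^sub>C real)"
    and \<beta> :: "nat \<Rightarrow> ('t \<Rightarrow>\<^sub>C real)"
    and P :: real
  assumes "compact (UNIV :: 's set)"
    and "compact (UNIV :: 't set)"
    and "bounded_bilinear \<omega>"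
    and "1 < P"
  shows "isometrically_isomorphic
           (dual_space (theta_lebesgue \<omega> \<alpha> \<beta> P))
           (theta_lebesgue \<omega> \<alpha> \<beta> (P / (P - 1)))"
  unfolding theta_lebesgue_def
  \<comment> \<open>Both spaces carry the same weight, so it remains that \<open>P / (P - 1)\<close>
    exceeds 1 and is conjugate to \<open>P\<close>, i.e.
    \<open>1 / P + (P - 1) / P = 1\<close>.\<close>
  using assms(4) by (intro dual_weighted_lp) (auto simp: field_simps)

end
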